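(* Let $\mathcal{C}$ be a component-based system and $\mu=(\mu_c)_{c\in\mathcal{C}}\in\mathcal{D}$, with system-level reduced basis (RB) residual and Jacobian $\mathbf{R}_{\mathrm{rb}},\mathbf{J}_{\mathrm{rb}}$, hyperreduced residual and Jacobian $\widetilde{\mathbf{R}}_{\mathrm{rb}},\widetilde{\mathbf{J}}_{\mathrm{rb}}$, their component-wise counterparts, and RB solution $\mathbf{u}_{\mathrm{rb}}(\mu)$, as defined in the context. Let $\bar{\mathbf{u}}_{\mathrm{rb}}(\mu)\in\mathbb{R}^{N_{\mathrm{rb}}}$ (the generalized coordinates of some $\bar u_{\mathrm{rb}}(\mu)\in\mathcal{V}_{\mathrm{rb}}$) be such that $$\|\mathbf{u}_{\mathrm{rb}}(\mu)-\bar{\mathbf{u}}_{\mathrm{rb}}(\mu)\|_2\le\bar\varepsilon$$ for some $\bar\varepsilon\ge0$ and $\mathbf{J}_{\mathrm{rb}}(\bar{\mathbf{u}}_{\mathrm{rb}}(\mu);\mu)$ is nonsingular. Let $\sigma\equiv\sigma_{\min}(\mathbf{J}_{\mathrm{rb}}(\bar{\mathbf{u}}_{\mathrm{rb}}(\mu);\mu))$. Suppose that for some $\delta_{R_c}\ge0$ and $\delta_{J_c}\ge0$, $c\in\mathcal{C}$, with $\sum_{c\in\mathcal{C}}N_{M(c)}\delta_{J_c}<\sigma$, the following hold for all $c\in\mathcal{C}$: $$\big\|\widetilde{\mathbf{R}}_{\mathrm{rb},c}(\mathbf{P}_{\mathrm{rb},c}^T\bar{\mathbf{u}}_{\mathrm{rb}}(\mu);\mu_c)\big\|_\infty\le\delta_{R_c},$$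 $$\big\|\mathbf{J}_{\mathrm{rb},c}(\mathbf{P}_{\mathrm{rb},c}^T\bar{\mathbf{u}}_{\mathrm{rb}}(\mu);\mu_c)-\widetilde{\mathbf{J}}_{\mathrm{rb},c}(\mathbf{P}_{\mathrm{rb},c}^T\bar{\mathbf{u}}_{\mathrm{rb}}(\mu);\mu_c)\big\|_{\max}\le\delta_{J_c}.$$ Let $$L(\alpha)\equiv2\sup_{\mathbf{w}\in\bar B(\bar{\mathbf{u}}_{\mathrm{rb}}(\mu),\alpha)}\big\|\mathbf{J}_{\mathrm{rb}}^{-1}(\bar{\mathbf{u}}_{\mathrm{rb}}(\mu);\mu)\,\widetilde{\mathbf{J}}_{\mathrm{rb}}(\mathbf{w};\mu)-\mathbf{I}\big\|_2,\qquad \bar\alpha\equiv\frac{2\sum_{c\in\mathcal{C}}\sqrt{N_{M(c)}}\,\delta_{R_c}}{\sigma-\sum_{c\in\mathcal{C}}N_{M(c)}\delta_{J_c}},$$ and assume $$L(\bar\alpha)\le\frac{\sigma-\sum_{c\in\mathcal{C}}N_{M(c)}\delta_{J_c}}{2\sigma}.$$ Then, for all $\lambda\ge\bar\alpha$ such that $L(\lambda)\le(\sigma-\sum_{c\in\mathcal{C}}N_{M(c)}\delta_{J_c})/\sigma$, there exists a unique solution $\widetilde{\mathbf{u}}_{\mathrm{rb}}(\mu)\in\mathbb{R}^{N_{\mathrm{rb}}}$ of $\widetilde{\mathbf{R}}_{\mathrm{rb}}(\widetilde{\mathbf{u}}_{\mathrm{rb}}(\mu);\mu)=0$ in the ball $\bar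 B(\bar{\mathbf{u}}_{\mathrm{rb}}(\mu),\lambda)$. Furthermore, $$\|\mathbf{u}_{\mathrm{rb}}(\mu)-\widetilde{\mathbf{u}}_{\mathrm{rb}}(\mu)\|_2\le\bar\alpha+\bar\varepsilon.$$
   Context: **Archetype components.** A library $\widehat{\mathcal{C}}$ is a finite set of archetype components. Each $\hat c\in\widehat{\mathcal{C}}$ has a bounded Lipschitz reference domain $\widehat\Omega_{\hat c}\subset\mathbb{R}^d$, a bounded parameter domain $\widehat{\mathcal{D}}_{\hat c}$, finitely many disjoint local ports $\hat\gamma_{\hat c,p}\subset\partial\widehat\Omega_{\hat c}$, $p\in\mathcal{P}_{\hat c}$, and a conforming finite element space $\widehat{\mathcal{V}}_{h,\hat c}\subset H^1(\widehat\Omega_{\hat c})$. The bubble space $\widehat{\mathcal{V}}^{\mathrm b}_{h,\hat c}$ consists of the functions of $\widehat{\mathcal{V}}_{h,\hat c}$ vanishing on all ports. For each port $p$, $\hat\psi^p_{\hat c,i}$, $i=1,\dots,\mathcal{N}^p_{\hat c}$, are the functions in $\widehat{\mathcal{V}}_{h,\hat c}$ obtained by discrete harmonic lifting (zero on the other ports) of a basis of $\widehat{\mathcal{V}}_{h,\hat c}|_{\hat\gamma_{\hat c,p}}$ made of $L^2$-normalized eigenfunctions of the port Laplacian. A bubble reduced basis $\{\hat\xi^{\mathrm b}_{\hat c,i}\}_{i=1}^{N^{\mathrm b}_{\hat c}}\subset\widehat{\mathcal{V}}^{\mathrm b}_{h,\hat c}$ is given. Put $N_{\hat c}=N^{\mathrm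 b}_{\hat c}+\sum_{p\in\mathcal{P}_{\hat c}}\mathcal{N}^p_{\hat c}$ and let $\{\widehat\Psi_{\hat c,i}\}_{i=1}^{N_{\hat c}}$ be the concatenation of the bubble reduced basis and all the port functions. Each $\hat c$ has a residual integrand $\hat r_{\hat c}(w,v;\hat x,\mu)\in\mathbb{R}$, linear in $v$ and in general nonlinear in $w$, with Gateaux derivative with respect to $w$ in direction $z$ denoted $\hat r'_{\hat c}(w,z,v;\hat x,\mu)$. It also has a truth quadrature rule $(\hat x_{\hat c,q},\hat\rho_{\hat c,q})_{q=1}^{Q_{\hat c}}$, and a reduced quadrature rule $(\tilde x^r_{\hat c,q},\tilde\rho^r_{\hat c,q})_{q=1}^{\widetilde Q^r_{\hat c}}$ whose points form a subset of the truth points, with new positive weights. **System.** A system $\mathcal{C}$ is a finite set of instantiated components; $M:\mathcal{C}\to\widehat{\mathcal{C}}$ gives the archetype of each. $c\in\mathcal{C}$ has parameter $\mu_c\in\mathcal{D}_c\equiv\widehat{\mathcal{D}}_{M(c)}$, and physical domain $\Omega_c=\mathcal{G}_c(\widehat\Omega_{M(c)};\mu_c)$ for a geometric mapping $\mathcal{G}_c(\cdot;\mu_c)$. $\mu=(\mu_c)_{c\in\mathcal{C}}\in\mathcal{D}\equiv\oplus_{c}\mathcal{D}_c$, and $\overline\Omega=\cup_c\overline\Omega_c$. Components are joined through local ports into global ports, each shared by at most two instantiated components; connected ports are conforming, i.e. the port basis functions and their coefficients are identified. Homogeneous Dirichlet conditions are imposed on a nonempty $\Gamma_D\subset\partial\Omega$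 made of nonshared ports. **Reduced space.** $\mathcal{V}_{\mathrm{rb}}$, of dimension $N_{\mathrm{rb}}$, is the space of $v\in H^1(\Omega)$ with $v|_{\Gamma_D}=0$ such that each $v|_{\Omega_c}$ lies in the span of $\Psi_{c,i}=\widehat\Psi_{M(c),i}\circ\mathcal{G}_c^{-1}(\cdot;\mu_c)$, $i=1,\dots,N_{M(c)}$. Its basis consists of the bubble reduced basis functions of all components (extended by zero) and the port functions of the global ports (glued across shared ports). Boldface letters denote vectors of generalized coordinates in this basis. $\mathbf{P}_{\mathrm{rb},c}:\mathbb{R}^{N_{M(c)}}\to\mathbb{R}^{N_{\mathrm{rb}}}$ is the linear extension operator mapping component degrees of freedom (DoF) to system DoF, i.e. the $0$-$1$ matrix sending each local DoF of $c$ to the corresponding global DoF (distinct local DoF of a component correspond to distinct global DoF; DoF removed by Dirichlet conditions are sent to $0$). Thus $\mathbf{P}_{\mathrm{rb},c}^T\mathbf{w}$ are the coordinates on $\Omega_c$ of the function with coordinates $\mathbf{w}$. **Residuals and Jacobians.** For $\mathbf{w}\in\mathbb{R}^{N_{M(c)}}$ put $\hat w=\sum_j\mathbf{w}_j\widehat\Psi_{M(c),j}$, and for $1\le i,j\le N_{M(c)}$ $$(\mathbf{R}_{\mathrm{rb},c}(\mathbf{w};\mu_c))_i=\sum_{q=1}^{Q_{M(c)}}\hat\rho_{M(c),q}\,\hat r_{M(c)}(\hat w,\widehat\Psi_{M(c),i};\hat x_{M(c),q},\mu_c),$$ $$(\mathbf{J}_{\mathrm{rb},c}(\mathbf{w};\mu_c))_{i,j}=\sum_{q=1}^{Q_{M(c)}}\hat\rho_{M(c),q}\,\hat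 r'_{M(c)}(\hat w,\widehat\Psi_{M(c),j},\widehat\Psi_{M(c),i};\hat x_{M(c),q},\mu_c).$$ $\widetilde{\mathbf{R}}_{\mathrm{rb},c},\widetilde{\mathbf{J}}_{\mathrm{rb},c}$ are defined by the same formulas with the truth quadrature rule replaced by the reduced quadrature rule. For $\mathbf{w}\in\mathbb{R}^{N_{\mathrm{rb}}}$, $$\mathbf{R}_{\mathrm{rb}}(\mathbf{w};\mu)=\sum_{c\in\mathcal{C}}\mathbf{P}_{\mathrm{rb},c}\mathbf{R}_{\mathrm{rb},c}(\mathbf{P}_{\mathrm{rb},c}^T\mathbf{w};\mu_c),\qquad \mathbf{J}_{\mathrm{rb}}(\mathbf{w};\mu)=\sum_{c\in\mathcal{C}}\mathbf{P}_{\mathrm{rb},c}\mathbf{J}_{\mathrm{rb},c}(\mathbf{P}_{\mathrm{rb},c}^T\mathbf{w};\mu_c)\mathbf{P}_{\mathrm{rb},c}^T,$$ and likewise $\widetilde{\mathbf{R}}_{\mathrm{rb}},\widetilde{\mathbf{J}}_{\mathrm{rb}}$ from $\widetilde{\mathbf{R}}_{\mathrm{rb},c},\widetilde{\mathbf{J}}_{\mathrm{rb},c}$. The RB problem is assumed well-posed, and $\mathbf{u}_{\mathrm{rb}}(\mu)\in\mathbb{R}^{N_{\mathrm{rb}}}$ denotes its solution: $\mathbf{R}_{\mathrm{rb}}(\mathbf{u}_{\mathrm{rb}}(\mu);\mu)=0$. **Norms.** $\|\cdot\|_2$ is the Euclidean/spectral norm, $\|\cdot\|_\infty$ the vector max norm,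 $\|\mathbf{A}\|_{\max}=\max_{i,j}|A_{i,j}|$, $\sigma_{\min}$ the minimum singular value, $\bar B(\mathbf{v},\alpha)=\{\mathbf{z}:\|\mathbf{z}-\mathbf{v}\|_2\le\alpha\}$, and $\mathbf{I}$ the identity matrix. *)

theory Defs
  imports "HOL-Analysis.Analysis"
begin

section \<open>Domains and Sobolev functions\<close>

definition smooth_fun :: "('a::euclidean_space \<Rightarrow> real) \<Rightarrow> bool" where
  "smooth_fun f \<longleftrightarrow> (\<exists>S. f \<in> S \<and> (\<forall>g\<in>S. (\<forall>x. g differentiable (at x)) \<and>
     (\<forall>b\<in>Basis. (\<lambda>x. frechet_derivative g (at x) b) \<in> S)))"
  \<comment> \<open>\<open>S\<close> collects all iterated partial derivatives, so this is $C^\infty$ on the whole space\<close>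

definition test_functions :: "'a::euclidean_space set \<Rightarrow> ('a \<Rightarrow> real) set" where
  "test_functions \<Omega> = {\<phi>. smooth_fun \<phi> \<and> compact (closure {x. \<phi> x \<noteq> 0}) \<and> closure {x. \<phi> x \<noteq> 0} \<subseteq> \<Omega>}"

definition is_weak_gradient ::
    "'a::euclidean_space set \<Rightarrow> ('a \<Rightarrow> real) \<Rightarrow> ('a \<Rightarrow> 'a) \<Rightarrow> bool" where
  "is_weak_gradient \<Omega> f G \<longleftrightarrow>
     G \<in> borel_measurable (lebesgue_on \<Omega>) \<and>
     integrable (lebesgue_on \<Omega>) (\<lambda>x. (norm (G x))\<^sup>2) \<and>
     (\<forall>\<phi>\<in>test_functions \<Omega>. \<forall>b\<in>Basis.
        (LINT x|lebesgue_on \<Omega>. f x * frechet_derivative \<phi> (at x) b)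
          = - (LINT x|lebesgue_on \<Omega>. (G x \<bullet> b) * \<phi> x))"

definition H1 :: "'a::euclidean_space set \<Rightarrow> ('a \<Rightarrow> real) set" where
  "H1 \<Omega> = {f. f \<in> borel_measurable (lebesgue_on \<Omega>) \<and>
     integrable (lebesgue_on \<Omega>) (\<lambda>x. (f x)\<^sup>2) \<and> (\<exists>G. is_weak_gradient \<Omega> f G)}"

definition weak_gradient :: "'a::euclidean_space set \<Rightarrow> ('a \<Rightarrow> real) \<Rightarrow> 'a \<Rightarrow> 'a" where
  "weak_gradient \<Omega> f = (SOME G. is_weak_gradient \<Omega> f G)"
  \<comment> \<open>for \<open>f \<in> H1 \<Omega>\<close> this is determined almost everywhere\<close>

text \<open>Near each boundary point, the domain is one side of the graph of a Lipschitz function over a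
  hyperplane; \<open>y - x - ((y - x) \<bullet> e) *\<^sub>R e\<close> is the projection to the hyperplane orthogonal to \<open>e\<close>.\<close>

definition lipschitz_domain :: "'a::euclidean_space set \<Rightarrow> bool" where
  "lipschitz_domain \<Omega> \<longleftrightarrow> open \<Omega> \<and> connected \<Omega> \<and> \<Omega> \<noteq> {} \<and>
     (\<forall>x\<in>frontier \<Omega>. \<exists>e r K \<phi>. norm e = 1 \<and> r > 0 \<and> K-lipschitz_on UNIV (\<phi> :: 'a \<Rightarrow> real) \<and>
        \<Omega> \<inter> ball x r =
          {y \<in> ball x r. (y - x) \<bullet> e > \<phi> (y - x - ((y - x) \<bullet> e) *\<^sub>R e)})"


section \<open>Surface measure and tangential gradient on ports\<close>

definition hausdorff_outer :: "nat \<Rightarrow> 'a::metric_space set \<Rightarrow> ennreal" where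
  "hausdorff_outer k A = (SUP \<delta>\<in>{0::real<..}.
     INF U\<in>{U :: nat \<Rightarrow> 'a set. A \<subseteq> (\<Union>j. U j) \<and> (\<forall>j. bounded (U j) \<and> diameter (U j) \<le> \<delta>)}.
       (\<Sum>j. if U j = {} then 0
             else ennreal (unit_ball_vol (real k) * (diameter (U j) / 2) ^ k)))"

text \<open>The $(d-1)$-dimensional Hausdorff measure restricted to \<open>\<gamma>\<close>; the outer measure is countably
  additive on the Borel sets by Caratheodory's criterion.\<close>

definition surface_measure :: "'a::euclidean_space set \<Rightarrow> 'a measure" where
  "surface_measure \<gamma> =
     restrict_space
       (completion (measure_of UNIV (sets borel) (hausdorff_outer (DIM('a) - 1)))) \<gamma>"

text \<open>The vectors representing the derivative of \<open>f\<close> within \<open>\<gamma>\<close> differ by normal vectors, so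
  the one of least norm is the tangential gradient.\<close>

definition tangential_gradient ::
    "'a::euclidean_space set \<Rightarrow> ('a \<Rightarrow> real) \<Rightarrow> 'a \<Rightarrow> 'a" where
  "tangential_gradient \<gamma> f x =
     arg_min norm (\<lambda>G. (f has_derivative (\<lambda>h. G \<bullet> h)) (at x within \<gamma>))"

definition port_laplace_eigenfunction ::
    "('a::euclidean_space \<Rightarrow> real) set \<Rightarrow> 'a set \<Rightarrow> ('a \<Rightarrow> real) \<Rightarrow> bool" where
  "port_laplace_eigenfunction V \<gamma> f \<longleftrightarrow> (\<exists>ev::real. \<forall>v\<in>V.
     (LINT x|surface_measure \<gamma>. tangential_gradient \<gamma> f x \<bullet> tangential_gradient \<gamma> v x)
       = ev * (LINT x|surface_measure \<gamma>. f x * v x))"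


section \<open>Finite-dimensional function spaces\<close>

definition restr :: "'a set \<Rightarrow> ('a \<Rightarrow> real) \<Rightarrow> 'a \<Rightarrow> real" where
  "restr S f = (\<lambda>x. if x \<in> S then f x else 0)"

definition fun_span :: "'i set \<Rightarrow> ('i \<Rightarrow> 'a \<Rightarrow> real) \<Rightarrow> ('a \<Rightarrow> real) set" where
  "fun_span I f = {(\<lambda>x. \<Sum>i\<in>I. a i * f i x) | a. True}"

definition fun_indep :: "'i set \<Rightarrow> ('i \<Rightarrow> 'a \<Rightarrow> real) \<Rightarrow> bool" where
  "fun_indep I f \<longleftrightarrow> (\<forall>a. (\<forall>x. (\<Sum>i\<in>I. a i * f i x) = 0) \<longrightarrow> (\<forall>i\<in>I. a i = 0))"

definition fun_basis :: "'i set \<Rightarrow> ('i \<Rightarrow> 'a \<Rightarrow> real) \<Rightarrow> ('a \<Rightarrow> real) set \<Rightarrow> bool" where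
  "fun_basis I f V \<longleftrightarrow> finite I \<and> fun_indep I f \<and> V = fun_span I f"

text \<open>Finite element functions are represented by their continuous versions on \<open>closure \<Omega>\<close>,
  extended by zero.\<close>

definition conforming_fe_space :: "'a::euclidean_space set \<Rightarrow> ('a \<Rightarrow> real) set \<Rightarrow> bool" where
  "conforming_fe_space \<Omega> V \<longleftrightarrow>
     (\<exists>(n::nat) f. fun_basis {..<n} f V) \<and> V \<subseteq> H1 \<Omega> \<and>
     (\<forall>v\<in>V. continuous_on (closure \<Omega>) v \<and> (\<forall>x. x \<notin> closure \<Omega> \<longrightarrow> v x = 0)) \<and>
     (\<exists>mesh. finite mesh \<and> \<Union>mesh = closure \<Omega> \<and>
        (\<forall>K\<in>mesh. compact K \<and> interior K \<noteq> {} \<and> K = closure (interior K)) \<and>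
        pairwise (\<lambda>K K'. interior K \<inter> interior K' = {}) mesh \<and>
        (\<forall>v\<in>V. \<forall>K\<in>mesh. \<exists>g. smooth_fun g \<and> (\<forall>x\<in>K. v x = g x)))"


section \<open>Archetype components\<close>

text \<open>Quadrature rules are lists of pairs (point, weight). Indices of ports, port functions and
  bubble functions are natural numbers, starting at zero. \<open>resid a w v x m\<close> is the residual
  integrand at the point \<open>x\<close> and the parameter \<open>m\<close>.\<close>

record ('a, 'p) archetype =
  ref_dom :: "'a set"
  par_dom :: "'p set"
  port_ids :: "nat set"
  port :: "nat \<Rightarrow> 'a set"
  fe_space :: "('a \<Rightarrow> real) set"
  n_bubble :: nat
  bubble_fun :: "nat \<Rightarrow> 'a \<Rightarrow> real"
  n_port :: "nat \<Rightarrow> nat"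
  port_fun :: "nat \<Rightarrow> nat \<Rightarrow> 'a \<Rightarrow> real"
  resid :: "('a \<Rightarrow> real) \<Rightarrow> ('a \<Rightarrow> real) \<Rightarrow> 'a \<Rightarrow> 'p \<Rightarrow> real"
  truth_rule :: "('a \<times> real) list"
  reduced_rule :: "('a \<times> real) list"

definition bubble_space :: "('a, 'p) archetype \<Rightarrow> ('a \<Rightarrow> real) set" where
  "bubble_space a = {v \<in> fe_space a. \<forall>p\<in>port_ids a. \<forall>x\<in>port a p. v x = 0}"

definition gateaux ::
    "('a, 'p) archetype \<Rightarrow> ('a \<Rightarrow> real) \<Rightarrow> ('a \<Rightarrow> real) \<Rightarrow> ('a \<Rightarrow> real) \<Rightarrow> 'a \<Rightarrow> 'p \<Rightarrow> real" where
  "gateaux a w z v x m = deriv (\<lambda>t. resid a (\<lambda>y. w y + t * z y) v x m) 0"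

definition residual_integrand :: "('a::euclidean_space, 'p) archetype \<Rightarrow> bool" where
  "residual_integrand a \<longleftrightarrow>
     (\<forall>x\<in>closure (ref_dom a). \<forall>m\<in>par_dom a. \<forall>w\<in>fe_space a.
       (\<forall>v1\<in>fe_space a. \<forall>v2\<in>fe_space a. \<forall>s t.
          resid a w (\<lambda>y. s * v1 y + t * v2 y) x m = s * resid a w v1 x m + t * resid a w v2 x m) \<and>
       (\<forall>v\<in>fe_space a.
          (\<forall>z\<in>fe_space a.
             ((\<lambda>t. resid a (\<lambda>y. w y + t * z y) v x m) has_real_derivative gateaux a w z v x m) (at 0)) \<and>
          (\<forall>z1\<in>fe_space a. \<forall>z2\<in>fe_space a. \<forall>s t.
             gateaux a w (\<lambda>y. s * z1 y + t * z2 y) v x m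
               = s * gateaux a w z1 v x m + t * gateaux a w z2 v x m)))"

text \<open>The port functions on \<open>port a p\<close> have traces forming a basis of normalized eigenfunctions;
  the last two conditions on them say that \<open>port_fun a p i\<close> is the discrete harmonic lifting of
  its trace.\<close>

definition archetype_component :: "('a::euclidean_space, 'p::euclidean_space) archetype \<Rightarrow> bool" where
  "archetype_component a \<longleftrightarrow>
     bounded (ref_dom a) \<and> lipschitz_domain (ref_dom a) \<and> bounded (par_dom a) \<and>
     finite (port_ids a) \<and> disjoint_family_on (port a) (port_ids a) \<and>
     conforming_fe_space (ref_dom a) (fe_space a) \<and>
     (\<forall>p\<in>port_ids a.
        port a p \<noteq> {} \<and> port a p \<in> sets borel \<and> port a p \<subseteq> frontier (ref_dom a) \<and>
        (\<forall>i<n_port a p. port_fun a p i \<in> fe_space a) \<and>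
        fun_basis {..<n_port a p} (\<lambda>i. restr (port a p) (port_fun a p i))
          (restr (port a p) ` fe_space a) \<and>
        (\<forall>i<n_port a p. port_laplace_eigenfunction (fe_space a) (port a p) (port_fun a p i) \<and>
          (LINT x|surface_measure (port a p). (port_fun a p i x)\<^sup>2) = 1) \<and>
        (\<forall>i<n_port a p. \<forall>p'\<in>port_ids a. p' \<noteq> p \<longrightarrow> (\<forall>x\<in>port a p'. port_fun a p i x = 0)) \<and>
        (\<forall>i<n_port a p. \<forall>v\<in>bubble_space a.
          (LINT x|lebesgue_on (ref_dom a).
             weak_gradient (ref_dom a) (port_fun a p i) x \<bullet> weak_gradient (ref_dom a) v x) = 0)) \<and>
     (\<forall>i<n_bubble a. bubble_fun a i \<in> bubble_space a) \<and>
     fun_indep {..<n_bubble a} (bubble_fun a) \<and>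
     residual_integrand a \<and>
     fst ` set (truth_rule a) \<subseteq> closure (ref_dom a) \<and>
     fst ` set (reduced_rule a) \<subseteq> fst ` set (truth_rule a) \<and>
     (\<forall>(x, \<rho>)\<in>set (reduced_rule a). \<rho> > 0)"

text \<open>Local DoF are tagged by their kind instead of being numbered consecutively.\<close>

datatype local_dof = Bubble nat | Port nat nat

definition local_dofs :: "('a, 'p) archetype \<Rightarrow> local_dof set" where
  "local_dofs a = Bubble ` {..<n_bubble a} \<union> {Port p i | p i. p \<in> port_ids a \<and> i < n_port a p}"

definition N_dof :: "('a, 'p) archetype \<Rightarrow> nat" where
  "N_dof a = n_bubble a + (\<Sum>p\<in>port_ids a. n_port a p)"

lemma card_local_dofs:
  assumes "finite (port_ids a)"
  shows "finite (local_dofs a) \<and> card (local_dofs a) = N_dof a"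
proof -
  let ?S = "Sigma (port_ids a) (\<lambda>p. {..<n_port a p})"
  let ?P = "(\<lambda>(p, i). Port p i) ` ?S"
  have eq: "local_dofs a = Bubble ` {..<n_bubble a} \<union> ?P"
    by (auto simp: local_dofs_def)
  have "card ?P = card ?S" by (rule card_image) (auto simp: inj_on_def)
  also have "\<dots> = (\<Sum>p\<in>port_ids a. n_port a p)" using assms by simp
  finally have P: "card ?P = (\<Sum>p\<in>port_ids a. n_port a p)" .
  have B: "card (Bubble ` {..<n_bubble a}) = n_bubble a"
    by (subst card_image) (auto simp: inj_on_def)
  have fin: "finite ?P" using assms by auto
  have "Bubble ` {..<n_bubble a} \<inter> ?P = {}" by auto
  then show ?thesis unfolding eq N_dof_def using P B fin by (simp add: card_Un_disjoint)
qed

fun Psi :: "('a, 'p) archetype \<Rightarrow> local_dof \<Rightarrow> 'a \<Rightarrow> real" where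
  "Psi a (Bubble i) = bubble_fun a i"
| "Psi a (Port p i) = port_fun a p i"

definition component_residual ::
    "('a, 'p) archetype \<Rightarrow> ('a \<times> real) list \<Rightarrow> (local_dof \<Rightarrow> real) \<Rightarrow> 'p \<Rightarrow> local_dof \<Rightarrow> real" where
  "component_residual a rule w m l =
     (\<Sum>(x, \<rho>)\<leftarrow>rule. \<rho> * resid a (\<lambda>y. \<Sum>j\<in>local_dofs a. w j * Psi a j y) (Psi a l) x m)"

definition component_jacobian ::
    "('a, 'p) archetype \<Rightarrow> ('a \<times> real) list \<Rightarrow> (local_dof \<Rightarrow> real) \<Rightarrow> 'p
      \<Rightarrow> local_dof \<Rightarrow> local_dof \<Rightarrow> real" where
  "component_jacobian a rule w m l k =
     (\<Sum>(x, \<rho>)\<leftarrow>rule.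
        \<rho> * gateaux a (\<lambda>y. \<Sum>j\<in>local_dofs a. w j * Psi a j y) (Psi a k) (Psi a l) x m)"

text \<open>Inserting 0 matters only for empty index sets.\<close>

definition inf_norm :: "'i set \<Rightarrow> ('i \<Rightarrow> real) \<Rightarrow> real" where
  "inf_norm I v = Max (insert 0 ((\<lambda>i. \<bar>v i\<bar>) ` I))"

definition max_norm :: "'i set \<Rightarrow> 'j set \<Rightarrow> ('i \<Rightarrow> 'j \<Rightarrow> real) \<Rightarrow> real" where
  "max_norm I J A = Max (insert 0 ((\<lambda>(i, j). \<bar>A i j\<bar>) ` (I \<times> J)))"


section \<open>Component-based systems\<close>

text \<open>A local port is a pair of a component and a port index of its archetype. A global port is the
  set of the local ports that are identified in it; \<open>dir_ports\<close> are those that make up $\Gamma_D$.\<close>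

record ('a, 'p, 'c) system =
  comps :: "'c set"
  arch :: "'c \<Rightarrow> ('a, 'p) archetype"
  geo :: "'c \<Rightarrow> 'p \<Rightarrow> 'a \<Rightarrow> 'a"
  global_ports :: "('c \<times> nat) set set"
  dir_ports :: "('c \<times> nat) set set"

definition params :: "('a, 'p, 'c) system \<Rightarrow> ('c \<Rightarrow> 'p) set" where
  "params S = (\<Pi> c\<in>comps S. par_dom (arch S c))"

definition local_ports :: "('a, 'p, 'c) system \<Rightarrow> ('c \<times> nat) set" where
  "local_ports S = (SIGMA c:comps S. port_ids (arch S c))"

definition phys_dom :: "('a, 'p, 'c) system \<Rightarrow> ('c \<Rightarrow> 'p) \<Rightarrow> 'c \<Rightarrow> 'a set" where
  "phys_dom S \<mu> c = geo S c (\<mu> c) ` ref_dom (arch S c)"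

definition phys_port :: "('a, 'p, 'c) system \<Rightarrow> ('c \<Rightarrow> 'p) \<Rightarrow> 'c \<times> nat \<Rightarrow> 'a set" where
  "phys_port S \<mu> = (\<lambda>(c, p). geo S c (\<mu> c) ` port (arch S c) p)"

definition system_dom :: "('a::euclidean_space, 'p, 'c) system \<Rightarrow> ('c \<Rightarrow> 'p) \<Rightarrow> 'a set" where
  "system_dom S \<mu> = interior (\<Union>c\<in>comps S. closure (phys_dom S \<mu> c))"

definition Gamma_D :: "('a, 'p, 'c) system \<Rightarrow> ('c \<Rightarrow> 'p) \<Rightarrow> 'a set" where
  "Gamma_D S \<mu> = (\<Union>g\<in>dir_ports S. \<Union>k\<in>g. phys_port S \<mu> k)"

definition push ::
    "('a::euclidean_space, 'p, 'c) system \<Rightarrow> ('c \<Rightarrow> 'p) \<Rightarrow> 'c \<Rightarrow> ('a \<Rightarrow> real) \<Rightarrow> 'a \<Rightarrow> real" where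
  "push S \<mu> c f x = f (inv_into (closure (ref_dom (arch S c))) (geo S c (\<mu> c)) x)"

text \<open>The functions in $H^1(\Omega)$ are represented by their continuous versions on the closure
  of $\Omega$, extended by zero.\<close>

definition V_rb ::
    "('a::euclidean_space, 'p, 'c) system \<Rightarrow> ('c \<Rightarrow> 'p) \<Rightarrow> ('a \<Rightarrow> real) set" where
  "V_rb S \<mu> = {v \<in> H1 (system_dom S \<mu>).
     (\<forall>x. x \<notin> closure (system_dom S \<mu>) \<longrightarrow> v x = 0) \<and>
     (\<forall>x\<in>Gamma_D S \<mu>. v x = 0) \<and>
     (\<forall>c\<in>comps S. \<exists>w. \<forall>x\<in>closure (phys_dom S \<mu> c).
        v x = (\<Sum>l\<in>local_dofs (arch S c). w l * push S \<mu> c (Psi (arch S c) l) x))}"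

datatype 'c global_dof = GBubble 'c nat | GPort "('c \<times> nat) set" nat

definition global_dofs :: "('a, 'p, 'c) system \<Rightarrow> 'c global_dof set" where
  "global_dofs S =
     {GBubble c i | c i. c \<in> comps S \<and> i < n_bubble (arch S c)} \<union>
     {GPort g i | g i. g \<in> global_ports S - dir_ports S \<and> (\<exists>(c, p)\<in>g. i < n_port (arch S c) p)}"

text \<open>Bubble functions are extended by zero, port functions are glued: on a shared port
  the choice of the component does not matter, by conformity.\<close>

fun rb_fun ::
    "('a::euclidean_space, 'p, 'c) system \<Rightarrow> ('c \<Rightarrow> 'p) \<Rightarrow> 'c global_dof \<Rightarrow> 'a \<Rightarrow> real" where
  "rb_fun S \<mu> (GBubble c i) x =
     (if x \<in> closure (phys_dom S \<mu> c) then push S \<mu> c (bubble_fun (arch S c) i) x else 0)"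
| "rb_fun S \<mu> (GPort g i) x =
     (if \<exists>(c, p)\<in>g. x \<in> closure (phys_dom S \<mu> c)
      then (let (c, p) = (SOME (c, p). (c, p) \<in> g \<and> x \<in> closure (phys_dom S \<mu> c))
            in push S \<mu> c (port_fun (arch S c) p i) x)
      else 0)"

definition component_system ::
    "('a::euclidean_space, 'p::euclidean_space) archetype set \<Rightarrow> ('a, 'p, 'c) system \<Rightarrow> bool" where
  "component_system lib S \<longleftrightarrow>
     finite lib \<and> (\<forall>a\<in>lib. archetype_component a) \<and>
     finite (comps S) \<and> arch S ` comps S \<subseteq> lib \<and>
     partition_on (local_ports S) (global_ports S) \<and>
     (\<forall>g\<in>global_ports S. card g \<le> 2 \<and> inj_on fst g) \<and>
     dir_ports S \<noteq> {} \<and> dir_ports S \<subseteq> {g \<in> global_ports S. card g = 1} \<and>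
     (\<forall>\<mu>\<in>params S.
        (\<forall>c\<in>comps S.
           continuous_on (closure (ref_dom (arch S c))) (geo S c (\<mu> c)) \<and>
           inj_on (geo S c (\<mu> c)) (closure (ref_dom (arch S c)))) \<and>
        disjoint_family_on (phys_dom S \<mu>) (comps S) \<and>
        (\<forall>c\<in>comps S. \<forall>c'\<in>comps S. c \<noteq> c' \<longrightarrow>
           closure (phys_dom S \<mu> c) \<inter> closure (phys_dom S \<mu> c')
             \<subseteq> \<Union>{closure (phys_port S \<mu> (c, p)) | p. \<exists>g\<in>global_ports S. \<exists>p'. (c, p) \<in> g \<and> (c', p') \<in> g}) \<and>
        (\<forall>g\<in>global_ports S. \<forall>(c, p)\<in>g. \<forall>(c', p')\<in>g.
           phys_port S \<mu> (c, p) = phys_port S \<mu> (c', p') \<and>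
           n_port (arch S c) p = n_port (arch S c') p' \<and>
           (\<forall>i<n_port (arch S c) p. \<forall>x\<in>phys_port S \<mu> (c, p).
              push S \<mu> c (port_fun (arch S c) p i) x = push S \<mu> c' (port_fun (arch S c') p' i) x)) \<and>
        Gamma_D S \<mu> \<subseteq> frontier (system_dom S \<mu>) \<and>
        fun_basis (global_dofs S) (rb_fun S \<mu>) (V_rb S \<mu>))"

fun global_of :: "('a, 'p, 'c) system \<Rightarrow> 'c \<Rightarrow> local_dof \<Rightarrow> 'c global_dof option" where
  "global_of S c (Bubble i) = Some (GBubble c i)"
| "global_of S c (Port p i) =
     (let g = (THE g. g \<in> global_ports S \<and> (c, p) \<in> g)
      in if g \<in> dir_ports S then None else Some (GPort g i))"

text \<open>From here on, \<open>dof\<close> is a bijection from the index type \<open>'n\<close> to the global DoF, so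
  that \<open>real ^ 'n\<close> is the space of coordinate vectors and \<open>CARD('n)\<close> is the dimension of \<open>V_rb\<close>.\<close>

definition P_mat ::
    "('a, 'p, 'c) system \<Rightarrow> ('n \<Rightarrow> 'c global_dof) \<Rightarrow> 'c \<Rightarrow> 'n \<Rightarrow> local_dof \<Rightarrow> real" where
  "P_mat S dof c k l = (if global_of S c l = Some (dof k) then 1 else 0)"

definition P_transpose ::
    "('a, 'p, 'c) system \<Rightarrow> ('n::finite \<Rightarrow> 'c global_dof) \<Rightarrow> 'c \<Rightarrow> real ^ 'n \<Rightarrow> local_dof \<Rightarrow> real" where
  "P_transpose S dof c w l = (\<Sum>k\<in>UNIV. P_mat S dof c k l * w $ k)"

definition assemble_vec ::
    "('a, 'p, 'c) system \<Rightarrow> ('n::finite \<Rightarrow> 'c global_dof) \<Rightarrow> 'c \<Rightarrow> (local_dof \<Rightarrow> real) \<Rightarrow> real ^ 'n" where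
  "assemble_vec S dof c v = (\<chi> k. \<Sum>l\<in>local_dofs (arch S c). P_mat S dof c k l * v l)"

definition assemble_mat ::
    "('a, 'p, 'c) system \<Rightarrow> ('n::finite \<Rightarrow> 'c global_dof) \<Rightarrow> 'c
      \<Rightarrow> (local_dof \<Rightarrow> local_dof \<Rightarrow> real) \<Rightarrow> real ^ 'n ^ 'n" where
  "assemble_mat S dof c A = (\<chi> k k'.
     \<Sum>l\<in>local_dofs (arch S c). \<Sum>l'\<in>local_dofs (arch S c).
       P_mat S dof c k l * A l l' * P_mat S dof c k' l')"

definition R_rb_comp ::
    "('a, 'p, 'c) system \<Rightarrow> 'c \<Rightarrow> (local_dof \<Rightarrow> real) \<Rightarrow> 'p \<Rightarrow> local_dof \<Rightarrow> real" where
  "R_rb_comp S c w m = component_residual (arch S c) (truth_rule (arch S c)) w m"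

definition J_rb_comp ::
    "('a, 'p, 'c) system \<Rightarrow> 'c \<Rightarrow> (local_dof \<Rightarrow> real) \<Rightarrow> 'p \<Rightarrow> local_dof \<Rightarrow> local_dof \<Rightarrow> real" where
  "J_rb_comp S c w m = component_jacobian (arch S c) (truth_rule (arch S c)) w m"

definition R_hr_comp ::
    "('a, 'p, 'c) system \<Rightarrow> 'c \<Rightarrow> (local_dof \<Rightarrow> real) \<Rightarrow> 'p \<Rightarrow> local_dof \<Rightarrow> real" where
  "R_hr_comp S c w m = component_residual (arch S c) (reduced_rule (arch S c)) w m"

definition J_hr_comp ::
    "('a, 'p, 'c) system \<Rightarrow> 'c \<Rightarrow> (local_dof \<Rightarrow> real) \<Rightarrow> 'p \<Rightarrow> local_dof \<Rightarrow> local_dof \<Rightarrow> real" where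
  "J_hr_comp S c w m = component_jacobian (arch S c) (reduced_rule (arch S c)) w m"

definition R_rb ::
    "('a, 'p, 'c) system \<Rightarrow> ('n::finite \<Rightarrow> 'c global_dof) \<Rightarrow> real ^ 'n \<Rightarrow> ('c \<Rightarrow> 'p) \<Rightarrow> real ^ 'n" where
  "R_rb S dof w \<mu> =
     (\<Sum>c\<in>comps S. assemble_vec S dof c (R_rb_comp S c (P_transpose S dof c w) (\<mu> c)))"

definition J_rb ::
    "('a, 'p, 'c) system \<Rightarrow> ('n::finite \<Rightarrow> 'c global_dof) \<Rightarrow> real ^ 'n \<Rightarrow> ('c \<Rightarrow> 'p) \<Rightarrow> real ^ 'n ^ 'n" where
  "J_rb S dof w \<mu> =
     (\<Sum>c\<in>comps S. assemble_mat S dof c (J_rb_comp S c (P_transpose S dof c w) (\<mu> c)))"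

definition R_hr ::
    "('a, 'p, 'c) system \<Rightarrow> ('n::finite \<Rightarrow> 'c global_dof) \<Rightarrow> real ^ 'n \<Rightarrow> ('c \<Rightarrow> 'p) \<Rightarrow> real ^ 'n" where
  "R_hr S dof w \<mu> =
     (\<Sum>c\<in>comps S. assemble_vec S dof c (R_hr_comp S c (P_transpose S dof c w) (\<mu> c)))"

definition J_hr ::
    "('a, 'p, 'c) system \<Rightarrow> ('n::finite \<Rightarrow> 'c global_dof) \<Rightarrow> real ^ 'n \<Rightarrow> ('c \<Rightarrow> 'p) \<Rightarrow> real ^ 'n ^ 'n" where
  "J_hr S dof w \<mu> =
     (\<Sum>c\<in>comps S. assemble_mat S dof c (J_hr_comp S c (P_transpose S dof c w) (\<mu> c)))"

definition rb_well_posed ::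
    "('a, 'p, 'c) system \<Rightarrow> ('n::finite \<Rightarrow> 'c global_dof) \<Rightarrow> bool" where
  "rb_well_posed S dof \<longleftrightarrow> (\<forall>\<mu>\<in>params S. \<exists>!w. R_rb S dof w \<mu> = 0)"

definition u_rb ::
    "('a, 'p, 'c) system \<Rightarrow> ('n::finite \<Rightarrow> 'c global_dof) \<Rightarrow> ('c \<Rightarrow> 'p) \<Rightarrow> real ^ 'n" where
  "u_rb S dof \<mu> = (THE w. R_rb S dof w \<mu> = 0)"


section \<open>Matrix quantities\<close>

definition singular_values :: "real ^ 'n ^ 'n \<Rightarrow> real set" where
  "singular_values A =
     {s. s \<ge> 0 \<and> (\<exists>x. x \<noteq> 0 \<and> (transpose A ** A) *v x = s\<^sup>2 *\<^sub>R x)}"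

definition sigma_min :: "real ^ 'n ^ 'n \<Rightarrow> real" where
  "sigma_min A = Min (singular_values A)"

definition spectral_norm :: "real ^ 'n ^ 'n \<Rightarrow> real" where
  "spectral_norm A = onorm (\<lambda>x. A *v x)"

text \<open>Extended reals, since the supremum may be infinite.\<close>

definition L_const ::
    "('a, 'p, 'c) system \<Rightarrow> ('n::finite \<Rightarrow> 'c global_dof) \<Rightarrow> ('c \<Rightarrow> 'p) \<Rightarrow> real ^ 'n \<Rightarrow> real \<Rightarrow> ereal" where
  "L_const S dof \<mu> ubar \<alpha> = 2 * (SUP w\<in>cball ubar \<alpha>.
     ereal (spectral_norm (matrix_inv (J_rb S dof ubar \<mu>) ** J_hr S dof w \<mu> - mat 1)))"

end

theory Submission
  imports Defs
begin

text \<open>Roots of the hyperreduced residual $\widetilde R$ are the fixed points of the simplified Newton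
  map $G(w) = w - J^{-1} \widetilde R(w)$, where $J$ is the reduced basis Jacobian frozen at
  $\bar u$. Along every line, $\widetilde R$ has the derivative given by $\widetilde J$, so the mean
  value inequality makes $G$ Lipschitz on a ball of radius $\alpha$ with constant
  $\sup \|I - J^{-1} \widetilde J(w)\|_2 = L(\alpha) / 2$ (\<open>simplified_newton_lipschitz\<close>).

  With $\theta = (\sigma - \sum_c N_{M(c)} \delta_{J_c}) / \sigma \in (0, 1]$, the two bounds on $L$
  give the constants $\theta / 4$ on the ball of radius $\bar\alpha$ and $\theta / 2$ on that of
  radius $\lambda$. The first step of the iteration from $\bar u$ has length at most
  $\|J^{-1}\|_2 \|\widetilde R(\bar u)\|_2 \le \sigma^{-1} \sum_c \sqrt{N_{M(c)}} \delta_{R_c}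
  = \theta \bar\alpha / 2$, because $\|J^{-1}\|_2 \le 1 / \sigma$ (\<open>norm_matrix_inv_le\<close>) and because
  scattering the component vectors into the system vector does not increase Euclidean norms
  (\<open>norm_R_hr_le\<close>). As $\theta / 2 + \theta / 4 \le 1$, the map $G$ sends the ball of radius
  $\bar\alpha$ into itself and Banach's fixed point theorem yields a root there
  (\<open>simplified_newton_root\<close>). Since $G$ is also a contraction on the ball of radius $\lambda$, this
  root is the only one in that ball, so it lies within $\bar\alpha$ of $\bar u$ and hence within
  $\bar\alpha + \bar\varepsilon$ of the reduced basis solution.\<close>

section \<open>The smallest singular value\<close>

lemma inner_gram_eq: "x \<bullet> ((transpose A ** A) *v y) = (A *v x) \<bullet> (A *v y)"
  for A :: "real ^ 'n ^ 'n"
  by (metis dot_lmul_matrix inner_commute matrix_vector_mul_assoc transpose_matrix_vector)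

text \<open>Eigenvectors of $A^T A$ for distinct eigenvalues are orthogonal, so there is room for only
  finitely many. The minimum that defines \<open>sigma_min\<close> is meaningful only because of this.\<close>

lemma finite_singular_values: "finite (singular_values A)"
  for A :: "real ^ 'n ^ 'n"
proof -
  let ?B = "transpose A ** A"
  have "\<exists>f. \<forall>s\<in>singular_values A. f s \<noteq> 0 \<and> ?B *v f s = s\<^sup>2 *\<^sub>R f s"
    by (rule bchoice) (auto simp: singular_values_def)
  then obtain f where f0: "\<And>s. s \<in> singular_values A \<Longrightarrow> f s \<noteq> 0"
    and f: "\<And>s. s \<in> singular_values A \<Longrightarrow> ?B *v f s = s\<^sup>2 *\<^sub>R f s" by blast
  have orth: "f s \<bullet> f t = 0"
    if s: "s \<in> singular_values A" and t: "t \<in> singular_values A" and "s \<noteq> t" for s t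
  proof -
    have "s\<^sup>2 * (f s \<bullet> f t) = f t \<bullet> (?B *v f s)" by (simp add: f[OF s] inner_commute)
    also have "\<dots> = f s \<bullet> (?B *v f t)" by (simp add: inner_gram_eq inner_commute)
    also have "\<dots> = t\<^sup>2 * (f s \<bullet> f t)" by (simp add: f[OF t])
    finally have "s\<^sup>2 = t\<^sup>2 \<or> f s \<bullet> f t = 0" by (simp add: disj_commute)
    moreover have "s\<^sup>2 \<noteq> t\<^sup>2"
      using s t \<open>s \<noteq> t\<close> by (simp add: singular_values_def power2_eq_iff_nonneg)
    ultimately show ?thesis by blast
  qed
  have inj: "inj_on f (singular_values A)"
    using orth f0 by (metis inj_onI inner_eq_zero_iff)
  have "independent (f ` singular_values A)"
    by (rule pairwise_orthogonal_independent)
      (auto simp: pairwise_def orthogonal_def intro!: orth dest: f0)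
  then show ?thesis
    using inj finite_imageD finiteI_independent by blast
qed

text \<open>A minimizer $x$ of the Rayleigh quotient of $A^T A$ is an eigenvector: the quadratic form
  $q(y) = \|A y\|^2 - m^2 \|y\|^2$ is nonnegative and vanishes at $x$, so its first variation
  at $x$ is zero. That variation is tested in the direction $b = A^T A x - m^2 x$ itself.\<close>

lemma minimal_stretch_singular_value:
  fixes A :: "real ^ 'n ^ 'n"
  assumes x: "norm x = 1" and min: "\<And>y. norm y = 1 \<Longrightarrow> norm (A *v x) \<le> norm (A *v y)"
  shows "norm (A *v x) \<in> singular_values A"
proof -
  define m where "m = norm (A *v x)"
  define b where "b = (transpose A ** A) *v x - m\<^sup>2 *\<^sub>R x"
  have stretch: "m * norm y \<le> norm (A *v y)" for y
  proof (cases "y = 0")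
    case False
    then have "m \<le> norm (A *v ((1 / norm y) *\<^sub>R y))"
      unfolding m_def by (intro min) simp
    with False show ?thesis by (simp add: matrix_vector_mult_scaleR field_simps)
  qed simp
  have eq_gram: "(transpose A ** A) *v x = b + m\<^sup>2 *\<^sub>R x" by (simp add: b_def)
  define q where "q y = (A *v y) \<bullet> (A *v y) - m\<^sup>2 * (y \<bullet> y)" for y
  have q_nonneg: "q y \<ge> 0" for y
  proof -
    have "(m * norm y)\<^sup>2 \<le> (norm (A *v y))\<^sup>2"
      by (intro power_mono stretch) (simp add: m_def)
    then show ?thesis by (simp add: q_def power_mult_distrib power2_norm_eq_inner)
  qed
  have qx: "q x = 0"
    using x by (simp add: q_def m_def power2_norm_eq_inner norm_eq_1)
  have expand: "q (x + t *\<^sub>R b) = q x + 2 * t * (b \<bullet> b) + t\<^sup>2 * q b" for t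
  proof -
    have bb: "(A *v b) \<bullet> (A *v x) = b \<bullet> b + m\<^sup>2 * (b \<bullet> x)"
      using inner_gram_eq[of b A x] by (simp add: eq_gram inner_add_right)
    have "q (x + t *\<^sub>R b) = q x + 2 * t * ((A *v b) \<bullet> (A *v x) - m\<^sup>2 * (b \<bullet> x)) + t\<^sup>2 * q b"
      by (simp add: q_def matrix_vector_right_distrib matrix_vector_mult_scaleR inner_add_left
          inner_add_right inner_commute power2_eq_square algebra_simps)
    then show ?thesis by (simp add: bb)
  qed
  have "b \<bullet> b = 0"
  proof (rule ccontr)
    assume "b \<bullet> b \<noteq> 0"
    then have bb: "b \<bullet> b > 0" by (simp add: inner_gt_zero_iff)
    \<comment> \<open>minimizes $2 t (b \cdot b) + t^2 (q(b) + 1)$; the added 1 avoids a division by $q(b) = 0$\<close>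
    define t where "t = - (b \<bullet> b) / (q b + 1)"
    have qb: "q b + 1 > 0" using q_nonneg[of b] by simp
    have "0 \<le> 2 * t * (b \<bullet> b) + t\<^sup>2 * q b" using q_nonneg[of "x + t *\<^sub>R b"] expand qx by simp
    also have "\<dots> \<le> 2 * t * (b \<bullet> b) + t\<^sup>2 * (q b + 1)" by (simp add: algebra_simps)
    also have "t\<^sup>2 * (q b + 1) = - (t * (b \<bullet> b))"
      using qb by (simp add: t_def power2_eq_square)
    also have "2 * t * (b \<bullet> b) + - (t * (b \<bullet> b)) = t * (b \<bullet> b)" by simp
    also have "\<dots> < 0"
      using qb bb by (intro mult_neg_pos) (simp_all add: t_def)
    finally show False by simp
  qed
  then have "(transpose A ** A) *v x = m\<^sup>2 *\<^sub>R x" by (simp add: eq_gram)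
  then show ?thesis
    using x unfolding singular_values_def m_def[symmetric]
    by (auto simp: m_def intro!: exI[of _ x])
qed

text \<open>The unit vector that is stretched least exists by compactness, and its stretch is a singular
  value, hence no less than the smallest one.\<close>

lemma sigma_min_stretch: "sigma_min A * norm x \<le> norm (A *v x)"
  for A :: "real ^ 'n ^ 'n"
proof (cases "x = 0")
  case False
  have "sphere (0 :: real ^ 'n) 1 \<noteq> {}"
    using False by (auto intro!: exI[of _ "(1 / norm x) *\<^sub>R x"])
  moreover have "continuous_on (sphere 0 1) (\<lambda>y. norm (A *v y))"
    by (intro continuous_on_norm matrix_vector_mult_linear_continuous_on)
  ultimately obtain z where "z \<in> sphere 0 1"
    and "\<forall>y\<in>sphere 0 1. norm (A *v z) \<le> norm (A *v y)"
    using continuous_attains_inf[OF compact_sphere] by blast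
  then have z: "norm z = 1" and min: "\<And>y. norm y = 1 \<Longrightarrow> norm (A *v z) \<le> norm (A *v y)"
    by auto
  have "sigma_min A \<le> norm (A *v z)"
    unfolding sigma_min_def
    by (intro Min_le finite_singular_values minimal_stretch_singular_value z min)
  also have "\<dots> \<le> norm (A *v ((1 / norm x) *\<^sub>R x))"
    using False by (intro min) simp
  finally show ?thesis using False by (simp add: matrix_vector_mult_scaleR field_simps)
qed simp

lemma matrix_inv_inverse:
  assumes "invertible A"
  shows "A ** matrix_inv A = mat 1" "matrix_inv A ** A = mat 1"
  using someI_ex[OF assms[unfolded invertible_def]] by (simp_all add: matrix_inv_def)

lemma norm_matrix_inv_le:
  fixes A :: "real ^ 'n ^ 'n"
  assumes "invertible A" "sigma_min A > 0"
  shows "norm (matrix_inv A *v y) \<le> norm y / sigma_min A"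
proof -
  have "A *v (matrix_inv A *v y) = y"
    using assms(1) by (simp add: matrix_vector_mul_assoc matrix_inv_inverse)
  with sigma_min_stretch[of A "matrix_inv A *v y"] assms(2) show ?thesis
    by (simp add: field_simps)
qed

lemma norm_matrix_vector_le_spectral: "norm (A *v x) \<le> spectral_norm A * norm x"
  for A :: "real ^ 'n ^ 'n"
  unfolding spectral_norm_def by (rule onorm[OF matrix_vector_mul_bounded_linear])


section \<open>The simplified Newton map\<close>

text \<open>The map $w \mapsto w - B F(w)$ has the derivative $I - B F'(w)$ along lines. By convexity
  of $K$ the bound on that derivative holds on the whole segment from $w$ to $v$, where the mean
  value inequality is applied.\<close>

lemma simplified_newton_lipschitz:
  fixes F :: "real ^ 'n \<Rightarrow> real ^ 'n" and B :: "real ^ 'n ^ 'n"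
  assumes deriv: "\<And>w z. ((\<lambda>t. F (w + t *\<^sub>R z)) has_vector_derivative F' w *v z) (at 0)"
    and bound: "\<And>w. w \<in> K \<Longrightarrow> spectral_norm (B ** F' w - mat 1) \<le> k"
    and K: "convex K" "v \<in> K" "w \<in> K"
  shows "dist (v - B *v F v) (w - B *v F w) \<le> k * dist v w"
proof -
  define g where "g t = (w + t *\<^sub>R (v - w)) - B *v F (w + t *\<^sub>R (v - w))" for t
  \<comment> \<open>the hypothesis differentiates at the parameter 0 only; moving the base point reaches every \<open>s\<close>\<close>
  have Fd: "((\<lambda>t. F (w + t *\<^sub>R z)) has_vector_derivative F' (w + s *\<^sub>R z) *v z) (at s)" for s z
  proof -
    have "((\<lambda>t. F ((w + s *\<^sub>R z) + t *\<^sub>R z)) \<circ> (\<lambda>t. t - s)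
        has_vector_derivative 1 *\<^sub>R (F' (w + s *\<^sub>R z) *v z)) (at s)"
      by (rule vector_diff_chain_at) (auto intro!: derivative_eq_intros deriv)
    then show ?thesis by (simp add: o_def scaleR_left_diff_distrib)
  qed
  have gd: "(g has_vector_derivative
      - ((B ** F' (w + t *\<^sub>R (v - w)) - mat 1) *v (v - w))) (at t)" for t
  proof -
    have "(g has_vector_derivative
        (v - w) - B *v (F' (w + t *\<^sub>R (v - w)) *v (v - w))) (at t)"
      unfolding g_def
      by (auto intro!: derivative_eq_intros Fd
          bounded_linear.has_vector_derivative[OF matrix_vector_mul_bounded_linear])
    then show ?thesis
      by (simp add: matrix_vector_mul_assoc matrix_vector_mult_diff_rdistrib)
  qed
  then have "continuous_on {0..1} g"
    by (meson continuous_at_imp_continuous_on has_vector_derivative_continuous)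
  then obtain t where t: "t \<in> {0<..<1}" and
    le: "norm (g 1 - g 0) \<le> norm ((1 - 0) *\<^sub>R - ((B ** F' (w + t *\<^sub>R (v - w)) - mat 1) *v (v - w)))"
    using mvt_general[of 0 1 g "\<lambda>t h. h *\<^sub>R - ((B ** F' (w + t *\<^sub>R (v - w)) - mat 1) *v (v - w))"]
      gd unfolding has_vector_derivative_def by auto
  have "w + t *\<^sub>R (v - w) = (1 - t) *\<^sub>R w + t *\<^sub>R v" by (simp add: algebra_simps)
  with t K have "w + t *\<^sub>R (v - w) \<in> K" by (simp add: convexD)
  have "norm (g 1 - g 0) \<le> norm ((B ** F' (w + t *\<^sub>R (v - w)) - mat 1) *v (v - w))"
    using le by simp
  also have "\<dots> \<le> spectral_norm (B ** F' (w + t *\<^sub>R (v - w)) - mat 1) * norm (v - w)"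
    by (rule norm_matrix_vector_le_spectral)
  also have "\<dots> \<le> k * norm (v - w)"
    by (intro mult_right_mono bound) (use \<open>w + t *\<^sub>R (v - w) \<in> K\<close> in auto)
  finally show ?thesis by (simp add: g_def dist_norm)
qed

text \<open>The condition on the first step is the one under which a map that contracts with factor $k$
  sends the ball into itself.\<close>

lemma simplified_newton_root:
  fixes F :: "real ^ 'n \<Rightarrow> real ^ 'n" and B :: "real ^ 'n ^ 'n"
  assumes deriv: "\<And>w z. ((\<lambda>t. F (w + t *\<^sub>R z)) has_vector_derivative F' w *v z) (at 0)"
    and inv: "invertible B"
    and bound: "\<And>w. w \<in> cball a \<rho> \<Longrightarrow> spectral_norm (B ** F' w - mat 1) \<le> k"
    and k: "0 \<le> k" "k < 1" and \<rho>: "0 \<le> \<rho>"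
    and start: "norm (B *v F a) \<le> (1 - k) * \<rho>"
  obtains u where "u \<in> cball a \<rho>" "F u = 0"
proof -
  define G where "G w = w - B *v F w" for w
  have lip: "dist (G v) (G w) \<le> k * dist v w" if "v \<in> cball a \<rho>" "w \<in> cball a \<rho>" for v w
    unfolding G_def
    by (rule simplified_newton_lipschitz[where F' = F', OF deriv bound convex_cball that])
  have "G w \<in> cball a \<rho>" if w: "w \<in> cball a \<rho>" for w
  proof -
    have "dist a (G w) \<le> dist a (G a) + dist (G a) (G w)" by (rule dist_triangle)
    also have "dist a (G a) = norm (B *v F a)" by (simp add: G_def dist_norm)
    also have "dist (G a) (G w) \<le> k * dist a w" using w \<rho> by (intro lip) auto
    also have "k * dist a w \<le> k * \<rho>" using w k by (intro mult_left_mono) auto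
    finally show ?thesis using start by (simp add: algebra_simps)
  qed
  then have "\<exists>!u\<in>cball a \<rho>. G u = u"
    using k \<rho> lip by (intro Banach_fix[of _ k]) (auto simp: complete_eq_closed)
  then obtain u where u: "u \<in> cball a \<rho>" "G u = u" by blast
  then have "B *v F u = B *v 0" by (simp add: G_def)
  then have "F u = 0"
    using inv by (metis invertible_def matrix_vector_mul_assoc matrix_vector_mul_lid)
  with u that show thesis by blast
qed

lemma simplified_newton_root_unique:
  fixes F :: "real ^ 'n \<Rightarrow> real ^ 'n" and B :: "real ^ 'n ^ 'n"
  assumes deriv: "\<And>w z. ((\<lambda>t. F (w + t *\<^sub>R z)) has_vector_derivative F' w *v z) (at 0)"
    and bound: "\<And>w. w \<in> K \<Longrightarrow> spectral_norm (B ** F' w - mat 1) \<le> k"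
    and K: "convex K" "u \<in> K" "v \<in> K" and "k < 1"
    and roots: "F u = 0" "F v = 0"
  shows "u = v"
proof (rule ccontr)
  assume "u \<noteq> v"
  have "dist u v \<le> k * dist u v"
    using simplified_newton_lipschitz[where F' = F' and B = B, OF deriv bound K] roots by simp
  also have "\<dots> < 1 * dist u v"
    using \<open>u \<noteq> v\<close> \<open>k < 1\<close> by (intro mult_strict_right_mono) auto
  finally show False by simp
qed


section \<open>Differentiating the component residuals\<close>

text \<open>Linearity is available for combinations of two functions of \<open>V\<close> only, so membership in \<open>V\<close>
  has to be carried through the induction on the number of summands.\<close>

lemma linear_functional_sum:
  fixes V :: "('a \<Rightarrow> real) set" and f :: "'i \<Rightarrow> 'a \<Rightarrow> real"
  assumes V: "V \<noteq> {}" "\<And>u v s t. u \<in> V \<Longrightarrow> v \<in> V \<Longrightarrow> (\<lambda>y. s * u y + t * v y) \<in> V"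
    and T: "\<And>u v s t. u \<in> V \<Longrightarrow> v \<in> V \<Longrightarrow> T (\<lambda>y. s * u y + t * v y) = s * T u + t * (T v :: real)"
    and "finite J" "\<And>j. j \<in> J \<Longrightarrow> f j \<in> V"
  shows "(\<lambda>y. \<Sum>j\<in>J. c j * f j y) \<in> V \<and> T (\<lambda>y. \<Sum>j\<in>J. c j * f j y) = (\<Sum>j\<in>J. c j * T (f j))"
  using assms(4,5)
proof (induction J)
  case empty
  obtain u where "u \<in> V" using V by blast
  then show ?case using V(2)[of u u 0 0] T[of u u 0 0] by simp
next
  case (insert j J)
  then have f: "f j \<in> V" and s: "(\<lambda>y. \<Sum>j\<in>J. c j * f j y) \<in> V"
    and e: "T (\<lambda>y. \<Sum>j\<in>J. c j * f j y) = (\<Sum>j\<in>J. c j * T (f j))" by auto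
  show ?case
    using V(2)[OF f s, of "c j" 1] T[OF f s, of "c j" 1] e insert.hyps by simp
qed

lemma fe_space_lincomb:
  assumes "archetype_component a"
  shows "fe_space a \<noteq> {}"
    and "u \<in> fe_space a \<Longrightarrow> v \<in> fe_space a \<Longrightarrow> (\<lambda>y. s * u y + t * v y) \<in> fe_space a"
proof -
  obtain n :: nat and f where V: "fe_space a = fun_span {..<n} f"
    using assms by (auto simp: archetype_component_def conforming_fe_space_def fun_basis_def)
  show "fe_space a \<noteq> {}" by (auto simp: V fun_span_def)
  assume "u \<in> fe_space a" "v \<in> fe_space a"
  then obtain c d where "u = (\<lambda>x. \<Sum>i<n. c i * f i x)" "v = (\<lambda>x. \<Sum>i<n. d i * f i x)"
    by (auto simp: V fun_span_def)
  then have "(\<lambda>y. s * u y + t * v y) = (\<lambda>y. \<Sum>i<n. (s * c i + t * d i) * f i y)"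
    by (simp add: sum_distrib_left algebra_simps sum.distrib)
  then show "(\<lambda>y. s * u y + t * v y) \<in> fe_space a"
    by (auto simp: V fun_span_def intro: exI[of _ "\<lambda>i. s * c i + t * d i"])
qed

lemma Psi_in_fe_space:
  assumes "archetype_component a" "l \<in> local_dofs a"
  shows "Psi a l \<in> fe_space a"
  using assms by (auto simp: archetype_component_def local_dofs_def bubble_space_def)

lemma finite_local_dofs: "archetype_component a \<Longrightarrow> finite (local_dofs a)"
  by (simp add: card_local_dofs archetype_component_def)

lemma sum_Psi_in_fe_space:
  assumes "archetype_component a"
  shows "(\<lambda>y. \<Sum>j\<in>local_dofs a. w j * Psi a j y) \<in> fe_space a"
  using linear_functional_sum[of "fe_space a" "\<lambda>_. 0" "local_dofs a" "Psi a" w]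
    fe_space_lincomb[OF assms] Psi_in_fe_space[OF assms] finite_local_dofs[OF assms] by simp

text \<open>Moving the coefficients of a reduced function along a line moves the function along a line, so
  this is the Gateaux derivative of the integrand in the direction $\sum_k z_k \Psi_k$, expanded by
  its linearity in the direction.\<close>

lemma resid_has_derivative:
  assumes a: "archetype_component a" and x: "x \<in> closure (ref_dom a)" and m: "m \<in> par_dom a"
    and l: "l \<in> local_dofs a"
  defines "u \<equiv> \<lambda>w y. \<Sum>j\<in>local_dofs a. w j * Psi a j y"
  shows "((\<lambda>t. resid a (u (\<lambda>k. w k + t * z k)) (Psi a l) x m) has_real_derivative
      (\<Sum>k\<in>local_dofs a. gateaux a (u w) (Psi a k) (Psi a l) x m * z k)) (at 0)"
proof -
  have uw: "u v \<in> fe_space a" for v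
    unfolding u_def by (rule sum_Psi_in_fe_space[OF a])
  have "residual_integrand a" using a by (simp add: archetype_component_def)
  note integrand = bspec[OF bspec[OF bspec[OF this[unfolded residual_integrand_def] x] m] uw]
  note gateaux = bspec[OF conjunct2[OF integrand] Psi_in_fe_space[OF a l]]
  have "((\<lambda>t. resid a (\<lambda>y. u w y + t * u z y) (Psi a l) x m) has_real_derivative
      gateaux a (u w) (u z) (Psi a l) x m) (at 0)"
    using gateaux uw by blast
  moreover
  have uz: "u z = (\<lambda>y. \<Sum>k\<in>local_dofs a. z k * Psi a k y)" by (simp add: u_def)
  have "gateaux a (u w) (u z) (Psi a l) x m
      = (\<Sum>k\<in>local_dofs a. z k * gateaux a (u w) (Psi a k) (Psi a l) x m)"
    unfolding uz
  proof (rule conjunct2[OF linear_functional_sum[where V = "fe_space a"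
        and T = "\<lambda>v. gateaux a (u w) v (Psi a l) x m"]])
    fix v1 v2 s t assume "v1 \<in> fe_space a" "v2 \<in> fe_space a"
    then show "gateaux a (u w) (\<lambda>y. s * v1 y + t * v2 y) (Psi a l) x m =
        s * gateaux a (u w) v1 (Psi a l) x m + t * gateaux a (u w) v2 (Psi a l) x m"
      using gateaux by blast
  qed (use fe_space_lincomb[OF a] Psi_in_fe_space[OF a] finite_local_dofs[OF a] in auto)
  moreover have "u (\<lambda>k. w k + t * z k) = (\<lambda>y. u w y + t * u z y)" for t
    by (simp add: u_def fun_eq_iff algebra_simps sum.distrib sum_distrib_left)
  ultimately show ?thesis by (simp add: mult.commute)
qed

lemma component_residual_has_derivative:
  assumes a: "archetype_component a" and rule: "fst ` set rule \<subseteq> closure (ref_dom a)"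
    and m: "m \<in> par_dom a" and l: "l \<in> local_dofs a"
  shows "((\<lambda>t. component_residual a rule (\<lambda>k. w k + t * z k) m l) has_real_derivative
      (\<Sum>k\<in>local_dofs a. component_jacobian a rule w m l k * z k)) (at 0)"
  using rule
proof (induction rule)
  case Nil
  then show ?case by (simp add: component_residual_def component_jacobian_def)
next
  case (Cons p rule)
  obtain x \<rho> where p: "p = (x, \<rho>)" by fastforce
  from Cons p have x: "x \<in> closure (ref_dom a)" by auto
  have res: "component_residual a (p # rule) v m l =
      \<rho> * resid a (\<lambda>y. \<Sum>j\<in>local_dofs a. v j * Psi a j y) (Psi a l) x m
      + component_residual a rule v m l" for v
    by (simp add: component_residual_def p)
  have jac: "(\<Sum>k\<in>local_dofs a. component_jacobian a (p # rule) w m l k * z k) =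
      \<rho> * (\<Sum>k\<in>local_dofs a. gateaux a (\<lambda>y. \<Sum>j\<in>local_dofs a. w j * Psi a j y)
          (Psi a k) (Psi a l) x m * z k)
      + (\<Sum>k\<in>local_dofs a. component_jacobian a rule w m l k * z k)"
    by (simp add: component_jacobian_def p sum.distrib sum_distrib_left algebra_simps)
  have "((\<lambda>t. component_residual a rule (\<lambda>k. w k + t * z k) m l) has_real_derivative
      (\<Sum>k\<in>local_dofs a. component_jacobian a rule w m l k * z k)) (at 0)"
    using Cons by auto
  then show ?case
    unfolding res jac
    by (intro DERIV_add DERIV_cmult resid_has_derivative[OF a x m l])
qed


section \<open>Assembling the system\<close>

lemma component_systemD:
  assumes "component_system lib S"
  shows "finite (comps S)" "c \<in> comps S \<Longrightarrow> archetype_component (arch S c)"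
    "partition_on (local_ports S) (global_ports S)"
    "g \<in> global_ports S \<Longrightarrow> inj_on fst g"
  using assms by (auto simp: component_system_def)

text \<open>The identity $(P A P^T) z = P (A (P^T z))$ for the extension operator $P$ of a component.\<close>

lemma assemble_mat_mult_vec:
  "assemble_mat S dof c A *v z =
     assemble_vec S dof c (\<lambda>l. \<Sum>l'\<in>local_dofs (arch S c). A l l' * P_transpose S dof c z l')"
proof -
  let ?D = "local_dofs (arch S c)"
  have "(\<Sum>k'\<in>UNIV. (\<Sum>l\<in>?D. \<Sum>l'\<in>?D.
         P_mat S dof c k l * A l l' * P_mat S dof c k' l') * z $ k')
     = (\<Sum>l\<in>?D. P_mat S dof c k l *
         (\<Sum>l'\<in>?D. A l l' * (\<Sum>k'\<in>UNIV. P_mat S dof c k' l' * z $ k')))" for k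
  proof -
    have "(\<Sum>k'\<in>UNIV. (\<Sum>l\<in>?D. \<Sum>l'\<in>?D. P_mat S dof c k l * A l l' * P_mat S dof c k' l') * z $ k')
        = (\<Sum>k'\<in>UNIV. \<Sum>l\<in>?D. \<Sum>l'\<in>?D.
            P_mat S dof c k l * (A l l' * (P_mat S dof c k' l' * z $ k')))"
      by (simp add: sum_distrib_left sum_distrib_right mult.assoc)
    also have "\<dots> = (\<Sum>l\<in>?D. \<Sum>k'\<in>UNIV. \<Sum>l'\<in>?D.
            P_mat S dof c k l * (A l l' * (P_mat S dof c k' l' * z $ k')))"
      by (rule sum.swap)
    also have "\<dots> = (\<Sum>l\<in>?D. \<Sum>l'\<in>?D. \<Sum>k'\<in>UNIV.
            P_mat S dof c k l * (A l l' * (P_mat S dof c k' l' * z $ k')))"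
      by (intro sum.cong refl sum.swap)
    finally show ?thesis by (simp add: sum_distrib_left)
  qed
  then show ?thesis
    by (simp add: assemble_mat_def assemble_vec_def matrix_vector_mult_def P_transpose_def)
qed

lemma P_transpose_add_scaleR:
  "P_transpose S dof c (w + t *\<^sub>R z) = (\<lambda>l. P_transpose S dof c w l + t * P_transpose S dof c z l)"
  by (simp add: P_transpose_def fun_eq_iff algebra_simps sum.distrib sum_distrib_left)

lemma assemble_vec_eq_sum:
  "assemble_vec S dof c v =
     (\<Sum>l\<in>local_dofs (arch S c). v l *\<^sub>R (\<chi> k. P_mat S dof c k l))"
  by (simp add: assemble_vec_def vec_eq_iff mult.commute)

text \<open>Assembly is linear and $P_c^T$ maps lines to lines, so differentiating the components
  gives $\sum_c P_c \widetilde J_c P_c^T z$, which is the assembled Jacobian applied to $z$.\<close>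

lemma R_hr_has_derivative:
  assumes S: "component_system lib S" and \<mu>: "\<mu> \<in> params S"
  shows "((\<lambda>t. R_hr S dof (w + t *\<^sub>R z) \<mu>) has_vector_derivative J_hr S dof w \<mu> *v z) (at 0)"
proof -
  have "J_hr S dof w \<mu> *v z = (\<Sum>c\<in>comps S. assemble_mat S dof c
      (J_hr_comp S c (P_transpose S dof c w) (\<mu> c)) *v z)"
    unfolding J_hr_def by (induction rule: infinite_finite_induct) (auto simp: matrix_vector_mult_add_rdistrib)
  also have "\<dots> = (\<Sum>c\<in>comps S. \<Sum>l\<in>local_dofs (arch S c).
      (\<Sum>l'\<in>local_dofs (arch S c). J_hr_comp S c (P_transpose S dof c w) (\<mu> c) l l'
         * P_transpose S dof c z l') *\<^sub>R (\<chi> k. P_mat S dof c k l))"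
    unfolding assemble_mat_mult_vec assemble_vec_eq_sum ..
  finally have J: "J_hr S dof w \<mu> *v z = \<dots>" .
  show ?thesis
    unfolding J R_hr_def assemble_vec_eq_sum P_transpose_add_scaleR R_hr_comp_def J_hr_comp_def
  proof (intro has_vector_derivative_sum)
    fix c l assume c: "c \<in> comps S" and l: "l \<in> local_dofs (arch S c)"
    note a = component_systemD(2)[OF S c]
    have m: "\<mu> c \<in> par_dom (arch S c)" using \<mu> c by (auto simp: params_def)
    have r: "fst ` set (reduced_rule (arch S c)) \<subseteq> closure (ref_dom (arch S c))"
      using a unfolding archetype_component_def by blast
    show "((\<lambda>t. component_residual (arch S c) (reduced_rule (arch S c))
          (\<lambda>l. P_transpose S dof c w l + t * P_transpose S dof c z l) (\<mu> c) l *\<^sub>R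
          (\<chi> k. P_mat S dof c k l)) has_vector_derivative
        (\<Sum>l'\<in>local_dofs (arch S c). component_jacobian (arch S c) (reduced_rule (arch S c))
           (P_transpose S dof c w) (\<mu> c) l l' * P_transpose S dof c z l') *\<^sub>R
          (\<chi> k. P_mat S dof c k l)) (at 0)"
      using has_vector_derivative_scaleR[OF component_residual_has_derivative[OF a r m l]
          has_vector_derivative_const] by simp
  qed
qed

text \<open>A component never meets itself in a global port: the local ports that are glued belong to
  different components.\<close>

lemma inj_on_global_of:
  assumes S: "component_system lib S" and c: "c \<in> comps S"
    and l: "l \<in> local_dofs (arch S c)" and l': "l' \<in> local_dofs (arch S c)"
    and eq: "global_of S c l = Some d" "global_of S c l' = Some d"
  shows "l = l'"
proof -
  note part = component_systemD(3)[OF S]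
  have the_port: "(THE g. g \<in> global_ports S \<and> (c, p) \<in> g) \<in> global_ports S \<and>
      (c, p) \<in> (THE g. g \<in> global_ports S \<and> (c, p) \<in> g)"
    if "p \<in> port_ids (arch S c)" for p
  proof (rule theI')
    have "(c, p) \<in> \<Union> (global_ports S)"
      using part c that by (auto simp: partition_on_def local_ports_def)
    moreover have "g = g'" if "g \<in> global_ports S" "g' \<in> global_ports S" "(c, p) \<in> g" "(c, p) \<in> g'" for g g'
      using part that by (auto simp: partition_on_def disjoint_def)
    ultimately show "\<exists>!g. g \<in> global_ports S \<and> (c, p) \<in> g" by blast
  qed
  have "p = p'" if "p \<in> port_ids (arch S c)" "p' \<in> port_ids (arch S c)"
    and "(THE g. g \<in> global_ports S \<and> (c, p) \<in> g) = (THE g. g \<in> global_ports S \<and> (c, p') \<in> g)"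
  for p p'
  proof -
    define g where "g = (THE g. g \<in> global_ports S \<and> (c, p) \<in> g)"
    have "g \<in> global_ports S" "(c, p) \<in> g" "(c, p') \<in> g"
      using the_port[OF that(1)] the_port[OF that(2)] unfolding that(3)[symmetric] g_def[symmetric]
      by auto
    then show ?thesis using component_systemD(4)[OF S, of g] by (auto dest: inj_onD[of fst g "(c, p)" "(c, p')"])
  qed
  with l l' eq show ?thesis
    by (auto simp: local_dofs_def Let_def split: if_splits)
qed

text \<open>The 0-1 matrix $P$ has at most one entry 1 in each row, by injectivity of the DoF map, and in
  each column. So $P v$ lists some of the entries of $v$ without repetition, which gives
  $\|P v\|_2 \le \|v\|_2 \le \sqrt{N} \|v\|_\infty$.\<close>

lemma norm_assemble_vec_le:
  fixes dof :: "'n::finite \<Rightarrow> 'c global_dof"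
  assumes S: "component_system lib S" and dof: "inj dof" and c: "c \<in> comps S"
    and v: "inf_norm (local_dofs (arch S c)) v \<le> \<delta>"
  shows "norm (assemble_vec S dof c v) \<le> sqrt (real (N_dof (arch S c))) * \<delta>"
proof -
  let ?D = "local_dofs (arch S c)"
  have fin: "finite ?D" by (rule finite_local_dofs[OF component_systemD(2)[OF S c]])
  have card: "card ?D = N_dof (arch S c)"
    using component_systemD(2)[OF S c] by (simp add: card_local_dofs archetype_component_def)
  have v_le: "\<bar>v l\<bar> \<le> \<delta>" if "l \<in> ?D" for l
    using v fin that unfolding inf_norm_def
    by (intro order_trans[OF Max_ge v[unfolded inf_norm_def]]) auto
  have "0 \<le> \<delta>"
    using fin by (intro order_trans[OF Max_ge v[unfolded inf_norm_def]]) auto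
  \<comment> \<open>a sum with at most one nonzero summand, whose coefficient is 1, can be squared termwise\<close>
  have row: "(assemble_vec S dof c v $ k)\<^sup>2 = (\<Sum>l\<in>?D. P_mat S dof c k l * (v l)\<^sup>2)" for k
  proof (cases "\<exists>l\<in>?D. P_mat S dof c k l \<noteq> 0")
    case True
    then obtain l where l: "l \<in> ?D" "global_of S c l = Some (dof k)"
      by (auto simp: P_mat_def split: if_splits)
    have P: "P_mat S dof c k l' = (if l' = l then 1 else 0)" if "l' \<in> ?D" for l'
    proof (cases "global_of S c l' = Some (dof k)")
      case True
      then show ?thesis using inj_on_global_of[OF S c that l(1) True l(2)] by (simp add: P_mat_def)
    qed (use l(2) in \<open>auto simp: P_mat_def\<close>)
    have "(\<Sum>l'\<in>?D. P_mat S dof c k l' * f l') = f l" for f :: "local_dof \<Rightarrow> real"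
    proof -
      have "(\<Sum>l'\<in>?D. P_mat S dof c k l' * f l') = (\<Sum>l'\<in>?D. if l' = l then f l' else 0)"
        by (rule sum.cong) (auto simp: P)
      then show ?thesis using fin l(1) by simp
    qed
    then show ?thesis by (simp add: assemble_vec_def)
  qed (simp add: assemble_vec_def)
  have col: "(\<Sum>k\<in>UNIV. P_mat S dof c k l) \<le> 1" for l
  proof (cases "\<exists>k. global_of S c l = Some (dof k)")
    case True
    then obtain k where "global_of S c l = Some (dof k)" by blast
    then have "P_mat S dof c k' l = (if k' = k then 1 else 0)" for k'
      using dof by (auto simp: P_mat_def dest: injD)
    then show ?thesis by simp
  qed (simp add: P_mat_def)
  have "(norm (assemble_vec S dof c v))\<^sup>2 = (\<Sum>k\<in>UNIV. (assemble_vec S dof c v $ k)\<^sup>2)"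
    by (simp add: norm_vec_def L2_set_def sum_nonneg)
  also have "\<dots> = (\<Sum>l\<in>?D. (\<Sum>k\<in>UNIV. P_mat S dof c k l) * (v l)\<^sup>2)"
    unfolding row sum_distrib_right by (rule sum.swap)
  also have "\<dots> \<le> (\<Sum>l\<in>?D. 1 * \<delta>\<^sup>2)"
    using v_le col \<open>0 \<le> \<delta>\<close> by (intro sum_mono mult_mono) (auto simp: abs_le_square_iff[symmetric])
  also have "\<dots> = (sqrt (real (N_dof (arch S c))) * \<delta>)\<^sup>2"
    by (simp add: card power_mult_distrib)
  finally show ?thesis
    by (rule power2_le_imp_le) (use \<open>0 \<le> \<delta>\<close> in simp)
qed

lemma norm_R_hr_le:
  fixes dof :: "'n::finite \<Rightarrow> 'c global_dof"
  assumes "component_system lib S" and "inj dof"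
    and "\<And>c. c \<in> comps S \<Longrightarrow>
      inf_norm (local_dofs (arch S c)) (R_hr_comp S c (P_transpose S dof c w) (\<mu> c)) \<le> \<delta> c"
  shows "norm (R_hr S dof w \<mu>) \<le> (\<Sum>c\<in>comps S. sqrt (real (N_dof (arch S c))) * \<delta> c)"
  unfolding R_hr_def
  by (intro order_trans[OF norm_sum] sum_mono norm_assemble_vec_le[OF assms(1,2)] assms(3))

lemma spectral_norm_le_of_L_const:
  assumes L: "L_const S dof \<mu> a r \<le> ereal s" and w: "w \<in> cball a r"
  shows "spectral_norm (matrix_inv (J_rb S dof a \<mu>) ** J_hr S dof w \<mu> - mat 1) \<le> s / 2"
proof -
  let ?n = "\<lambda>w. ereal (spectral_norm (matrix_inv (J_rb S dof a \<mu>) ** J_hr S dof w \<mu> - mat 1))"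
  have "?n w \<le> (SUP w\<in>cball a r. ?n w)" by (rule SUP_upper[OF w])
  then have "2 * ?n w \<le> L_const S dof \<mu> a r"
    unfolding L_const_def by (intro ereal_mult_left_mono) auto
  also note L
  finally show ?thesis by simp
qed


section \<open>Existence, uniqueness and error bound\<close>

theorem proposition6:
  fixes lib :: "('a::euclidean_space, 'p::euclidean_space) archetype set"
    and S :: "('a, 'p, 'c) system"
    and dof :: "'n::finite \<Rightarrow> 'c global_dof"
    and \<mu> :: "'c \<Rightarrow> 'p"
    and ubar :: "real ^ 'n"
    and \<epsilon> \<sigma> \<alpha>bar :: real
    and \<delta>R \<delta>J :: "'c \<Rightarrow> real"
  assumes system: "component_system lib S"
    and numbering: "bij_betw dof UNIV (global_dofs S)"
    and well_posed: "rb_well_posed S dof"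
    and param: "\<mu> \<in> params S"
    and eps: "\<epsilon> \<ge> 0" "norm (u_rb S dof \<mu> - ubar) \<le> \<epsilon>"
    and nonsingular: "invertible (J_rb S dof ubar \<mu>)"
    and sigma: "\<sigma> = sigma_min (J_rb S dof ubar \<mu>)"
    and deltas: "\<And>c. c \<in> comps S \<Longrightarrow> \<delta>R c \<ge> 0" "\<And>c. c \<in> comps S \<Longrightarrow> \<delta>J c \<ge> 0"
    and small: "(\<Sum>c\<in>comps S. real (N_dof (arch S c)) * \<delta>J c) < \<sigma>"
    and residual: "\<And>c. c \<in> comps S \<Longrightarrow>
        inf_norm (local_dofs (arch S c)) (R_hr_comp S c (P_transpose S dof c ubar) (\<mu> c)) \<le> \<delta>R c"
    and jacobian: "\<And>c. c \<in> comps S \<Longrightarrow>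
        max_norm (local_dofs (arch S c)) (local_dofs (arch S c))
          (\<lambda>i j. J_rb_comp S c (P_transpose S dof c ubar) (\<mu> c) i j
               - J_hr_comp S c (P_transpose S dof c ubar) (\<mu> c) i j) \<le> \<delta>J c"
    and alpha: "\<alpha>bar = 2 * (\<Sum>c\<in>comps S. sqrt (real (N_dof (arch S c))) * \<delta>R c)
        / (\<sigma> - (\<Sum>c\<in>comps S. real (N_dof (arch S c)) * \<delta>J c))"
    and L_alpha: "L_const S dof \<mu> ubar \<alpha>bar
        \<le> ereal ((\<sigma> - (\<Sum>c\<in>comps S. real (N_dof (arch S c)) * \<delta>J c)) / (2 * \<sigma>))"
  shows "\<forall>r\<ge>\<alpha>bar.
      L_const S dof \<mu> ubar r
        \<le> ereal ((\<sigma> - (\<Sum>c\<in>comps S. real (N_dof (arch S c)) * \<delta>J c)) / \<sigma>) \<longrightarrow>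
      (\<exists>!u. u \<in> cball ubar r \<and> R_hr S dof u \<mu> = 0) \<and>
      (\<forall>u. u \<in> cball ubar r \<and> R_hr S dof u \<mu> = 0 \<longrightarrow>
         norm (u_rb S dof \<mu> - u) \<le> \<alpha>bar + \<epsilon>)"
proof (intro allI impI)
  define \<beta> where "\<beta> = (\<Sum>c\<in>comps S. real (N_dof (arch S c)) * \<delta>J c)"
  define \<eta> where "\<eta> = (\<Sum>c\<in>comps S. sqrt (real (N_dof (arch S c))) * \<delta>R c)"
  define \<theta> where "\<theta> = (\<sigma> - \<beta>) / \<sigma>"
  define B where "B = matrix_inv (J_rb S dof ubar \<mu>)"
  have \<beta>: "0 \<le> \<beta>" "\<beta> < \<sigma>"
    using small deltas by (auto simp: \<beta>_def intro!: sum_nonneg)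
  have \<eta>: "0 \<le> \<eta>" using deltas by (auto simp: \<eta>_def intro!: sum_nonneg)
  have \<sigma>: "0 < \<sigma>" using \<beta> by simp
  have \<theta>: "0 < \<theta>" "\<theta> \<le> 1" using \<beta> \<sigma> by (auto simp: \<theta>_def)
  have \<alpha>bar: "0 \<le> \<alpha>bar" "\<eta> / \<sigma> = \<theta> * \<alpha>bar / 2"
    using \<beta> \<eta> \<sigma> by (auto simp: alpha \<beta>_def[symmetric] \<eta>_def[symmetric] \<theta>_def)
  note deriv = R_hr_has_derivative[OF system param, of dof]
  have inj: "inj dof" using numbering by (simp add: bij_betw_def)
  have inv: "invertible B"
    unfolding B_def using matrix_inv_inverse[OF nonsingular] invertible_def by blast
  have "norm (B *v R_hr S dof ubar \<mu>) \<le> norm (R_hr S dof ubar \<mu>) / \<sigma>"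
    unfolding B_def using norm_matrix_inv_le[OF nonsingular] \<sigma> sigma by simp
  also have "\<dots> \<le> \<eta> / \<sigma>"
    unfolding \<eta>_def using \<sigma> by (intro divide_right_mono norm_R_hr_le[OF system inj] residual) auto
  \<comment> \<open>$\theta / 2 \le 1 - \theta / 4$ leaves room for the contraction factor $\theta / 4$\<close>
  also have "\<dots> \<le> (1 - \<theta> / 4) * \<alpha>bar"
    unfolding \<alpha>bar(2) using mult_right_mono[OF \<theta>(2) \<alpha>bar(1)] \<alpha>bar(1) by (simp add: algebra_simps)
  finally have start: "norm (B *v R_hr S dof ubar \<mu>) \<le> (1 - \<theta> / 4) * \<alpha>bar" .
  have small_ball: "spectral_norm (B ** J_hr S dof w \<mu> - mat 1) \<le> \<theta> / 4" if "w \<in> cball ubar \<alpha>bar" for w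
    using spectral_norm_le_of_L_const[OF L_alpha that] by (simp add: B_def \<theta>_def \<beta>_def)
  obtain u where u: "u \<in> cball ubar \<alpha>bar" "R_hr S dof u \<mu> = 0"
    by (rule simplified_newton_root[where F' = "\<lambda>w. J_hr S dof w \<mu>", OF deriv inv small_ball _ _ \<alpha>bar(1) start])
      (use \<theta> in auto)
  fix r
  assume r: "\<alpha>bar \<le> r" and L_r: "L_const S dof \<mu> ubar r
        \<le> ereal ((\<sigma> - (\<Sum>c\<in>comps S. real (N_dof (arch S c)) * \<delta>J c)) / \<sigma>)"
  have large_ball: "spectral_norm (B ** J_hr S dof w \<mu> - mat 1) \<le> \<theta> / 2" if "w \<in> cball ubar r" for w
    using spectral_norm_le_of_L_const[OF L_r that] by (simp add: B_def \<theta>_def \<beta>_def)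
  have ur: "u \<in> cball ubar r" using u r by auto
  have unique: "v = u" if "v \<in> cball ubar r" "R_hr S dof v \<mu> = 0" for v
    by (rule simplified_newton_root_unique[where F' = "\<lambda>w. J_hr S dof w \<mu>",
          OF deriv large_ball convex_cball that(1) ur _ that(2) u(2)])
      (use \<theta> in auto)
  have "norm (u_rb S dof \<mu> - u) \<le> norm (u_rb S dof \<mu> - ubar) + norm (ubar - u)"
    using norm_triangle_ineq[of "u_rb S dof \<mu> - ubar" "ubar - u"] by simp
  also have "\<dots> \<le> \<epsilon> + \<alpha>bar"
    using eps(2) u(1) by (intro add_mono) (auto simp: dist_norm)
  finally have "norm (u_rb S dof \<mu> - u) \<le> \<alpha>bar + \<epsilon>" by simp
  then show "(\<exists>!u. u \<in> cball ubar r \<and> R_hr S dof u \<mu> = 0) \<and>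
      (\<forall>u. u \<in> cball ubar r \<and> R_hr S dof u \<mu> = 0 \<longrightarrow>
         norm (u_rb S dof \<mu> - u) \<le> \<alpha>bar + \<epsilon>)"
    using u ur unique by blast
qed

end
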